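(* Let $d=2$ and $k=1$, let $\Delta t,\lambda,\mathrm{Re}>0$, and let $\rho_h^{\mathrm P}\in M_h^1$ be positive at every vertex of every cell $K_i\in\mathcal{T}_h$ (trace from inside $K_i$). If the penalty parameter satisfies $\tilde\sigma>\frac{\sqrt2}{2}$, then the system matrix $$\mathsf{A}_{\mathcal M}+\frac{\Delta t\,\lambda}{\mathrm{Re}}\,\mathsf{A}_{\mathcal D}$$ of the $\mathbb{Q}^1$ IIPG discretization (evaluated with $2^2$-point Gauss–Lobatto quadrature) is a nonsingular M-matrix, and therefore is monotone (all entries of its inverse are nonnegative), with no restriction on $\Delta t$ or on the mesh size.
   Context: **Mesh and space.** $\Omega\subset\mathbb{R}^2$ is uniformly partitioned into a conforming mesh $\mathcal{T}_h=\{K_0,\dots,K_{N_{\mathrm{el}}-1}\}$ of axis-parallel squares of side $\Delta x$; $h=\sqrt2\,\Delta x$ is the diagonal length. $M_h^1=\{\chi\in L^2(\Omega):\chi|_K\in\mathbb{Q}^1(K)\ \forall K\in\mathcal{T}_h\}$ is the discontinuous piecewise bilinear space. On each $K_i$ the basis $\varphi_{i0},\dots,\varphi_{i3}$ consists of the bilinear Lagrange functions associated with the four vertices of $K_i$ (extended by zero outside $K_i$). **Faces.** $\partial\Omega=\partial\Omega_{\mathrm D}\cup\partial\Omega_{\mathrm N}$ is a disjoint partition of the boundary into unions of mesh faces (Dirichlet and homogeneous Neumann parts; $\partial\Omega_{\mathrm D}$ may be empty, i.e. the thermally insulating condition $\nabla e\cdot\mathbf{n}=0$ on all of $\partial\Omega$,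 or may be all of $\partial\Omega$). $\Gamma_h$ is the set of interior faces. For an interior face $e$ shared by $K_{i^-}$ and $K_{i^+}$, $i^-<i^+$, $\mathbf{n}_e$ points from $K_{i^-}$ into $K_{i^+}$, $\{\omega\}=\frac12\omega|_{K_{i^-}}+\frac12\omega|_{K_{i^+}}$, $[\omega]=\omega|_{K_{i^-}}-\omega|_{K_{i^+}}$; on a boundary face $\mathbf{n}_e$ is the outward normal and both $\{\omega\}$ and $[\omega]$ are the trace of $\omega$. **Form and matrices.** The IIPG bilinear form for $-\Delta$ is $$a_{\mathcal D}(e,\chi)=\sum_{K\in\mathcal{T}_h}\int_K\nabla e\cdot\nabla\chi-\sum_{e'\in\Gamma_h\cup\partial\Omega_{\mathrm D}}\int_{e'}\{\nabla e\cdot\mathbf{n}_{e'}\}[\chi]+\frac{\tilde\sigma}{h}\sum_{e'\in\Gamma_h\cup\partial\Omega_{\mathrm D}}\int_{e'}[e][\chi].$$ All integrals are evaluated with the $2^2$-point Gauss–Lobatto quadrature on cells (the four vertices, equal weights $\Delta x^2/4$) and the 2-point Gauss–Lobatto quadrature on faces (two endpoints, equal weights $\Delta x/2$). $\langle\cdot,\cdot\rangle$ is the $L^2(\Omega)$ inner product evaluated with this cell quadrature. Matrix entries are indexed by pairs: $[\mathsf{A}_{\mathcal M}]_{i'j';ij}=\langle\rho_h^{\mathrm P}\varphi_{ij},\varphi_{i'j'}\rangle$ and $[\mathsf{A}_{\mathcal D}]_{i'j';ij}=a_{\mathcal D}(\varphi_{ij},\varphi_{i'j'})$. **M-matrix.**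 A real square matrix $\mathsf{A}$ is an M-matrix if $\mathsf{A}=s\mathsf{I}-\mathsf{B}$ with $\mathsf{B}\ge0$ entrywise and $s$ greater than or equal to the spectral radius of $\mathsf{B}$. *)

theory Defs
  imports "HOL-Analysis.Analysis" "Jordan_Normal_Form.Spectral_Radius"
begin

text \<open>Points of the plane are pairs of reals.  A mesh is given by the number of its cells, their
  common side length and the lower left corner of each cell; the cells are numbered
  \<open>0, \<dots>, n_el - 1\<close>.\<close>

record square_mesh =
  n_el :: nat
  side :: real
  corner :: "nat \<Rightarrow> real \<times> real"

definition cell :: "square_mesh \<Rightarrow> nat \<Rightarrow> (real \<times> real) set" where
  "cell M i = cbox (corner M i) (corner M i + (side M, side M))"

definition mesh_size :: "square_mesh \<Rightarrow> real" where
  "mesh_size M = sqrt 2 * side M"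

text \<open>Local numbering of the vertices: lower left, lower right, upper left, upper right.
  The vertex diagonally opposite to \<open>j\<close> is \<open>3 - j\<close>.\<close>

definition vertex :: "square_mesh \<Rightarrow> nat \<Rightarrow> nat \<Rightarrow> real \<times> real" where
  "vertex M i j = corner M i + (real (j mod 2) * side M, real (j div 2) * side M)"

definition cell_vertices :: "square_mesh \<Rightarrow> nat \<Rightarrow> (real \<times> real) set" where
  "cell_vertices M i = vertex M i ` {..<4}"

definition cell_faces :: "square_mesh \<Rightarrow> nat \<Rightarrow> (real \<times> real) set set" where
  "cell_faces M i =
     {closed_segment (vertex M i 0) (vertex M i 1), closed_segment (vertex M i 1) (vertex M i 3),
      closed_segment (vertex M i 2) (vertex M i 3), closed_segment (vertex M i 0) (vertex M i 2)}"

definition conforming_mesh :: "square_mesh \<Rightarrow> bool" where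
  "conforming_mesh M \<longleftrightarrow> 0 < n_el M \<and> 0 < side M \<and>
     (\<forall>i<n_el M. \<forall>j<n_el M. i \<noteq> j \<longrightarrow>
        cell M i \<inter> cell M j = {} \<or>
        (\<exists>v \<in> cell_vertices M i \<inter> cell_vertices M j. cell M i \<inter> cell M j = {v}) \<or>
        cell M i \<inter> cell M j \<in> cell_faces M i \<inter> cell_faces M j)"

definition mesh_domain :: "square_mesh \<Rightarrow> (real \<times> real) set" where
  "mesh_domain M = interior (\<Union>i<n_el M. cell M i)"

definition mesh_faces :: "square_mesh \<Rightarrow> (real \<times> real) set set" where
  "mesh_faces M = (\<Union>i<n_el M. cell_faces M i)"

definition interior_faces :: "square_mesh \<Rightarrow> (real \<times> real) set set" where
  "interior_faces M = {F. \<exists>i j. i < j \<and> j < n_el M \<and> F \<in> cell_faces M i \<and> F \<in> cell_faces M j}"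

definition boundary_faces :: "square_mesh \<Rightarrow> (real \<times> real) set set" where
  "boundary_faces M = {F \<in> mesh_faces M. F \<subseteq> frontier (mesh_domain M)}"

text \<open>The indices \<open>i\<^sup>-\<close> and \<open>i\<^sup>+\<close> of the cells at a face; they coincide on a boundary face.\<close>

definition face_minus :: "square_mesh \<Rightarrow> (real \<times> real) set \<Rightarrow> nat" where
  "face_minus M F = Min {i. i < n_el M \<and> F \<in> cell_faces M i}"

definition face_plus :: "square_mesh \<Rightarrow> (real \<times> real) set \<Rightarrow> nat" where
  "face_plus M F = Max {i. i < n_el M \<and> F \<in> cell_faces M i}"

text \<open>The unit normal pointing out of the cell \<open>i\<^sup>-\<close>, characterized by the supporting half plane of
  that cell at \<open>F\<close>: on an interior face it points from \<open>i\<^sup>-\<close> into \<open>i\<^sup>+\<close>, on a boundary face it is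
  the outward normal of the domain.\<close>

definition face_normal :: "square_mesh \<Rightarrow> (real \<times> real) set \<Rightarrow> real \<times> real" where
  "face_normal M F =
     (THE n. norm n = 1 \<and> (\<forall>x\<in>F. \<forall>y\<in>cell M (face_minus M F). inner n (y - x) \<le> 0))"

definition Q1 :: "(real \<times> real \<Rightarrow> real) set" where
  "Q1 = {q. \<exists>a b c d. \<forall>x y. q (x, y) = a + b * x + c * y + d * x * y}"

text \<open>A member of the broken space is represented by a function that is bilinear on the interior of
  every cell.  Its values on cell boundaries are irrelevant: there only the one-sided limits
  \<open>cell_trace\<close> are ever used.\<close>

definition dg_space :: "square_mesh \<Rightarrow> (real \<times> real \<Rightarrow> real) set" where
  "dg_space M = {z. set_borel_measurable lebesgue (mesh_domain M) z \<and>
     set_integrable lebesgue (mesh_domain M) (\<lambda>x. (z x)\<^sup>2) \<and>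
     (\<forall>i<n_el M. \<exists>q\<in>Q1. \<forall>x\<in>interior (cell M i). z x = q x)}"

definition cell_trace :: "square_mesh \<Rightarrow> nat \<Rightarrow> (real \<times> real \<Rightarrow> real) \<Rightarrow> real \<times> real \<Rightarrow> real" where
  "cell_trace M i w x = Lim (at x within interior (cell M i)) w"

definition grad :: "(real \<times> real \<Rightarrow> real) \<Rightarrow> real \<times> real \<Rightarrow> real \<times> real" where
  "grad w x = (THE g. GDERIV w x :> g)"

definition lagrange :: "square_mesh \<Rightarrow> nat \<Rightarrow> nat \<Rightarrow> real \<times> real \<Rightarrow> real" where
  "lagrange M i j x =
     (let v = vertex M i j; u = vertex M i (3 - j)
      in (fst x - fst u) / (fst v - fst u) * ((snd x - snd u) / (snd v - snd u)))"

lemma lagrange_vertex: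
  assumes "side M \<noteq> 0" "j < 4" "k < 4"
  shows "lagrange M i j (vertex M i k) = (if k = j then 1 else 0)"
proof -
  have "j = 0 \<or> j = 1 \<or> j = 2 \<or> j = 3" "k = 0 \<or> k = 1 \<or> k = 2 \<or> k = 3"
    using assms by auto
  then show ?thesis
    using assms(1) by (elim disjE) (simp_all add: lagrange_def vertex_def)
qed

lemma lagrange_in_Q1: "lagrange M i j \<in> Q1"
proof -
  have bilinear: "\<exists>a b c d. \<forall>x y. (x - p) / r * ((y - q) / s) = a + b * x + c * y + d * x * y"
    for p q r s :: real
    by (rule exI[of _ "p * q / (r * s)"], rule exI[of _ "- q / (r * s)"],
        rule exI[of _ "- p / (r * s)"], rule exI[of _ "1 / (r * s)"])
       (simp add: diff_divide_distrib[symmetric] add_divide_distrib[symmetric] algebra_simps)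
  show ?thesis
    unfolding Q1_def lagrange_def Let_def by (simp add: bilinear[simplified])
qed

definition basis_fun :: "square_mesh \<Rightarrow> nat \<Rightarrow> nat \<Rightarrow> real \<times> real \<Rightarrow> real" where
  "basis_fun M i j x = (if x \<in> cell M i then lagrange M i j x else 0)"

definition average :: "square_mesh \<Rightarrow> (real \<times> real) set \<Rightarrow> (real \<times> real \<Rightarrow> real) \<Rightarrow> real \<times> real \<Rightarrow> real" where
  "average M F w x =
     (if F \<in> interior_faces M
      then 1/2 * cell_trace M (face_minus M F) w x + 1/2 * cell_trace M (face_plus M F) w x
      else cell_trace M (face_minus M F) w x)"

definition jump :: "square_mesh \<Rightarrow> (real \<times> real) set \<Rightarrow> (real \<times> real \<Rightarrow> real) \<Rightarrow> real \<times> real \<Rightarrow> real" where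
  "jump M F w x =
     (if F \<in> interior_faces M
      then cell_trace M (face_minus M F) w x - cell_trace M (face_plus M F) w x
      else cell_trace M (face_minus M F) w x)"

text \<open>Gauss--Lobatto quadrature.  The integrand on a cell is evaluated by its trace from inside the
  cell; the two nodes on a face are its endpoints.\<close>

definition quad_cell :: "square_mesh \<Rightarrow> nat \<Rightarrow> (real \<times> real \<Rightarrow> real) \<Rightarrow> real" where
  "quad_cell M i w = (\<Sum>j<4. (side M)\<^sup>2 / 4 * cell_trace M i w (vertex M i j))"

definition quad_face :: "square_mesh \<Rightarrow> (real \<times> real) set \<Rightarrow> (real \<times> real \<Rightarrow> real) \<Rightarrow> real" where
  "quad_face M F w = (\<Sum>x | x extreme_point_of F. side M / 2 * w x)"

definition discrete_inner :: "square_mesh \<Rightarrow> (real \<times> real \<Rightarrow> real) \<Rightarrow> (real \<times> real \<Rightarrow> real) \<Rightarrow> real" where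
  "discrete_inner M f g = (\<Sum>i<n_el M. quad_cell M i (\<lambda>x. f x * g x))"

text \<open>The IIPG form with penalty parameter \<open>\<sigma>\<close> and set \<open>FD\<close> of Dirichlet faces.\<close>

definition iipg_form ::
  "square_mesh \<Rightarrow> (real \<times> real) set set \<Rightarrow> real \<Rightarrow> (real \<times> real \<Rightarrow> real) \<Rightarrow> (real \<times> real \<Rightarrow> real) \<Rightarrow> real" where
  "iipg_form M FD \<sigma> w z =
     (\<Sum>i<n_el M. quad_cell M i (\<lambda>x. inner (grad w x) (grad z x)))
     - (\<Sum>F \<in> interior_faces M \<union> FD.
          quad_face M F (\<lambda>x. average M F (\<lambda>y. inner (grad w y) (face_normal M F)) x * jump M F z x))
     + \<sigma> / mesh_size M *
       (\<Sum>F \<in> interior_faces M \<union> FD. quad_face M F (\<lambda>x. jump M F w x * jump M F z x))"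

text \<open>The index pair \<open>(i, j)\<close> with \<open>i < n_el M\<close> and \<open>j < 4\<close> is stored at position \<open>4 * i + j\<close>; the
  row belongs to the test function, the column to the trial function.\<close>

definition pair_matrix :: "square_mesh \<Rightarrow> (nat \<Rightarrow> nat \<Rightarrow> nat \<Rightarrow> nat \<Rightarrow> real) \<Rightarrow> real Matrix.mat" where
  "pair_matrix M a = Matrix.mat (4 * n_el M) (4 * n_el M)
     (\<lambda>(r, c). a (r div 4) (r mod 4) (c div 4) (c mod 4))"

definition mass_matrix :: "square_mesh \<Rightarrow> (real \<times> real \<Rightarrow> real) \<Rightarrow> real Matrix.mat" where
  "mass_matrix M \<rho> = pair_matrix M
     (\<lambda>i' j' i j. discrete_inner M (\<lambda>x. \<rho> x * basis_fun M i j x) (basis_fun M i' j'))"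

definition diffusion_matrix :: "square_mesh \<Rightarrow> (real \<times> real) set set \<Rightarrow> real \<Rightarrow> real Matrix.mat" where
  "diffusion_matrix M FD \<sigma> = pair_matrix M
     (\<lambda>i' j' i j. iipg_form M FD \<sigma> (basis_fun M i j) (basis_fun M i' j'))"

definition nonneg_entries :: "real Matrix.mat \<Rightarrow> bool" where
  "nonneg_entries A \<longleftrightarrow> (\<forall>i<dim_row A. \<forall>j<dim_col A. 0 \<le> A $$ (i, j))"

definition M_matrix :: "real Matrix.mat \<Rightarrow> bool" where
  "M_matrix A \<longleftrightarrow> (\<exists>n s B. B \<in> carrier_mat n n \<and> A = s \<cdot>\<^sub>m 1\<^sub>m n - B \<and>
     nonneg_entries B \<and> spectral_radius (map_mat complex_of_real B) \<le> s)"

definition monotone_matrix :: "real Matrix.mat \<Rightarrow> bool" where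
  "monotone_matrix A \<longleftrightarrow> invertible_mat A \<and>
     (\<forall>B. inverts_mat A B \<and> inverts_mat B A \<longrightarrow> nonneg_entries B)"

end

theory Submission
  imports Defs
begin

unbundle no vec_syntax

text \<open>Quadrature at the vertices makes every matrix entry explicit, and the signs of the entries decide
  everything.  Three observations carry the proof.

  The basis functions sum to \<open>1\<close> in every cell.  A row sum of the diffusion matrix is therefore the
  form with the constant \<open>1\<close> as trial function: gradients and interior jumps vanish, and only the
  nonnegative penalty on the Dirichlet faces survives (\<open>iipg_form_row_sum_nonneg\<close>).  The mass matrix
  is diagonal with positive diagonal (\<open>mass_entry\<close>), so all row sums of the system matrix are positive.

  The off-diagonal entries of the diffusion matrix are nonpositive
  (\<open>iipg_form_offdiagonal_nonpos\<close>).  Two basis functions of one cell couple through the stiffness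
  term by \<open>-1/2\<close> if their vertices span an edge and by \<open>0\<close> if they lie on a diagonal.  In the first
  case a single face works against this: the one through the vertex of the test function,
  perpendicular to the edge.  Its consistency term adds \<open>1/4\<close> if the face is interior and \<open>1/2\<close> if it
  is a Dirichlet face, at most what the stiffness term pays for.  Basis functions of two neighbouring
  cells couple only across the common face.  At a common vertex the entry is
  \<open>1/4 - \<sigma> / (2 * sqrt 2)\<close>, where \<open>1/4\<close> comes from consistency and the rest from the penalty, and it
  is negative precisely for \<open>\<sigma> > sqrt 2 / 2\<close>; the vertex one edge further inside the trial
  function's cell contributes \<open>-1/4\<close>, all others \<open>0\<close>.

  A real matrix with nonpositive off-diagonal entries and positive row sums satisfies a discrete
  minimum principle (\<open>Z_matrix_positive_row_sums_minimum_principle\<close>): \<open>A x \<ge> 0\<close> forces \<open>x \<ge> 0\<close>.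
  Invertibility and nonnegativity of the inverse follow.  Shifting by the largest diagonal entry
  gives the splitting required of an M-matrix, the spectral radius being bounded by the row sums.\<close>

section \<open>Matrices with nonpositive off-diagonal entries and positive row sums\<close>

text \<open>Row \<open>k\<close> at an index \<open>k\<close> of a smallest entry: since the off-diagonal entries are nonpositive,
  replacing every \<open>x j\<close> by \<open>x k\<close> can only increase the value, which becomes \<open>x k\<close> times a positive row
  sum.\<close>

lemma Z_matrix_positive_row_sums_minimum_principle:
  fixes A :: "real Matrix.mat"
  assumes offdiag: "\<And>i j. i < n \<Longrightarrow> j < n \<Longrightarrow> i \<noteq> j \<Longrightarrow> A $$ (i, j) \<le> 0"
    and rows: "\<And>i. i < n \<Longrightarrow> 0 < (\<Sum>j<n. A $$ (i, j))"
    and Ax: "\<And>i. i < n \<Longrightarrow> 0 \<le> (\<Sum>j<n. A $$ (i, j) * x j)"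
    and i: "i < n"
  shows "0 \<le> x i"
proof -
  obtain k where k: "k < n" and min: "\<And>j. j < n \<Longrightarrow> x k \<le> x j"
  proof -
    have "Min (x ` {..<n}) \<in> x ` {..<n}"
      using i by (intro Min_in) auto
    then obtain k where "k < n" "x k = Min (x ` {..<n})" by auto
    then show thesis using that[of k] by simp
  qed
  have "(\<Sum>j<n. A $$ (k, j) * x j) \<le> (\<Sum>j<n. A $$ (k, j) * x k)"
  proof (rule sum_mono)
    fix j assume "j \<in> {..<n}"
    then show "A $$ (k, j) * x j \<le> A $$ (k, j) * x k"
      using offdiag[OF k, of j] min[of j] by (cases "j = k") (auto intro: mult_left_mono_neg)
  qed
  with Ax[OF k] have "0 \<le> (\<Sum>j<n. A $$ (k, j)) * x k"
    by (simp add: sum_distrib_right)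
  with rows[OF k] have "0 \<le> x k"
    by (simp add: zero_le_mult_iff)
  with min[OF i] show ?thesis by simp
qed

lemma mult_mat_vec_index_sum:
  assumes "A \<in> carrier_mat n n" "v \<in> carrier_vec n" "i < n"
  shows "(A *\<^sub>v v) $ i = (\<Sum>j<n. A $$ (i, j) * v $ j)"
  using assms by (auto simp: scalar_prod_def atLeast0LessThan intro!: sum.cong)

text \<open>The minimum principle for \<open>v\<close> and for \<open>- v\<close> shows that the kernel is trivial.\<close>

lemma Z_matrix_positive_row_sums_invertible:
  fixes A :: "real Matrix.mat"
  assumes A: "A \<in> carrier_mat n n"
    and offdiag: "\<And>i j. i < n \<Longrightarrow> j < n \<Longrightarrow> i \<noteq> j \<Longrightarrow> A $$ (i, j) \<le> 0"
    and rows: "\<And>i. i < n \<Longrightarrow> 0 < (\<Sum>j<n. A $$ (i, j))"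
  shows "invertible_mat A"
proof -
  have "Determinant.det A \<noteq> 0"
  proof
    assume "Determinant.det A = 0"
    then obtain v where v: "v \<in> carrier_vec n" "v \<noteq> 0\<^sub>v n" "A *\<^sub>v v = 0\<^sub>v n"
      using det_0_iff_vec_prod_zero_field[OF A] by auto
    have Av: "(\<Sum>j<n. A $$ (i, j) * v $ j) = 0" if "i < n" for i
      using mult_mat_vec_index_sum[OF A v(1) that] v(3) that by simp
    have "0 \<le> v $ i" if "i < n" for i
      by (rule Z_matrix_positive_row_sums_minimum_principle[OF offdiag rows _ that]) (auto simp: Av)
    moreover have "0 \<le> - v $ i" if "i < n" for i
      by (rule Z_matrix_positive_row_sums_minimum_principle[OF offdiag rows _ that])
        (auto simp: Av sum_negf)
    ultimately have "v = 0\<^sub>v n"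
      using v(1) by (intro eq_vecI) (auto intro!: antisym)
    with v(2) show False by simp
  qed
  from det_non_zero_imp_unit[OF A this, of "()"]
  obtain B where "B \<in> carrier_mat n n" "B * A = 1\<^sub>m n" "A * B = 1\<^sub>m n"
    unfolding Units_def ring_mat_def by auto
  then show ?thesis
    using A unfolding invertible_mat_def inverts_mat_def by auto
qed

text \<open>Each column of an inverse solves a system whose right-hand side is a unit vector, so the minimum
  principle applies to it.\<close>

lemma Z_matrix_positive_row_sums_monotone:
  fixes A :: "real Matrix.mat"
  assumes A: "A \<in> carrier_mat n n"
    and offdiag: "\<And>i j. i < n \<Longrightarrow> j < n \<Longrightarrow> i \<noteq> j \<Longrightarrow> A $$ (i, j) \<le> 0"
    and rows: "\<And>i. i < n \<Longrightarrow> 0 < (\<Sum>j<n. A $$ (i, j))"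
  shows "monotone_matrix A"
  unfolding monotone_matrix_def
proof (intro conjI allI impI)
  show "invertible_mat A"
    by (rule Z_matrix_positive_row_sums_invertible[OF assms])
  fix B assume inv: "inverts_mat A B \<and> inverts_mat B A"
  then have AB: "A * B = 1\<^sub>m n" and BA: "B * A = 1\<^sub>m (dim_row B)"
    using A by (auto simp: inverts_mat_def)
  have "dim_col B = n" using arg_cong[OF AB, of dim_col] by simp
  moreover have "dim_row B = n" using arg_cong[OF BA, of dim_col] A by simp
  ultimately have B: "B \<in> carrier_mat n n" by auto
  have "0 \<le> B $$ (i, c)" if i: "i < n" and c: "c < n" for i c
  proof (rule Z_matrix_positive_row_sums_minimum_principle[OF offdiag rows _ i])
    fix r assume r: "r < n"
    have "(\<Sum>j<n. A $$ (r, j) * B $$ (j, c)) = (A * B) $$ (r, c)"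
      using A B r c by (auto simp: scalar_prod_def atLeast0LessThan intro!: sum.cong)
    also have "\<dots> = (if r = c then 1 else 0)"
      using AB r c by simp
    finally show "0 \<le> (\<Sum>j<n. A $$ (r, j) * B $$ (j, c))" by simp
  qed auto
  then show "nonneg_entries B"
    using B by (auto simp: nonneg_entries_def)
qed

text \<open>The eigenvalue equation is read off in the row where the eigenvector has an entry of largest
  modulus.\<close>

lemma spectral_radius_le_max_row_sum:
  fixes B :: "real Matrix.mat"
  assumes B: "B \<in> carrier_mat n n" and n: "0 < n"
    and nonneg: "\<And>i j. i < n \<Longrightarrow> j < n \<Longrightarrow> 0 \<le> B $$ (i, j)"
    and rows: "\<And>i. i < n \<Longrightarrow> (\<Sum>j<n. B $$ (i, j)) \<le> s"
  shows "spectral_radius (map_mat complex_of_real B) \<le> s"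
proof -
  let ?C = "map_mat complex_of_real B"
  have C: "?C \<in> carrier_mat n n" using B by simp
  obtain ev where ev: "ev \<in> spectrum ?C" "spectral_radius ?C = norm ev"
    using spectral_radius_mem_max(1)[OF C n] by auto
  then obtain v where v: "v \<in> carrier_vec n" "v \<noteq> 0\<^sub>v n" "?C *\<^sub>v v = ev \<cdot>\<^sub>v v"
    using B unfolding spectrum_def eigenvalue_def eigenvector_def by auto
  obtain k where k: "k < n" and max: "\<And>j. j < n \<Longrightarrow> norm (v $ j) \<le> norm (v $ k)"
  proof -
    have "Max ((\<lambda>j. norm (v $ j)) ` {..<n}) \<in> (\<lambda>j. norm (v $ j)) ` {..<n}"
      using n by (intro Max_in) auto
    then obtain k where "k < n" "norm (v $ k) = Max ((\<lambda>j. norm (v $ j)) ` {..<n})" by auto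
    then show thesis using that[of k] by simp
  qed
  have "v $ k \<noteq> 0"
  proof
    assume "v $ k = 0"
    with max have "v = 0\<^sub>v n" using v(1) by (intro eq_vecI) auto
    with v(2) show False by simp
  qed
  have "ev * v $ k = (\<Sum>j<n. ?C $$ (k, j) * v $ j)"
    using mult_mat_vec_index_sum[OF C v(1) k] v(1,3) k by simp
  also have "\<dots> = (\<Sum>j<n. complex_of_real (B $$ (k, j)) * v $ j)"
    using B k by (intro sum.cong) auto
  finally have "norm ev * norm (v $ k) = norm (\<Sum>j<n. complex_of_real (B $$ (k, j)) * v $ j)"
    by (metis norm_mult)
  also have "\<dots> \<le> (\<Sum>j<n. B $$ (k, j) * norm (v $ k))"
  proof (rule sum_norm_le)
    fix j assume "j \<in> {..<n}"
    then show "norm (complex_of_real (B $$ (k, j)) * v $ j) \<le> B $$ (k, j) * norm (v $ k)"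
      using nonneg[OF k, of j] max[of j] by (auto simp: norm_mult intro: mult_left_mono)
  qed
  also have "\<dots> = (\<Sum>j<n. B $$ (k, j)) * norm (v $ k)"
    by (simp add: sum_distrib_right)
  also have "\<dots> \<le> s * norm (v $ k)"
    using rows[OF k] by (simp add: mult_right_mono)
  finally show ?thesis
    using \<open>v $ k \<noteq> 0\<close> ev(2) by simp
qed

text \<open>The shift \<open>s\<close> is the largest diagonal entry; it makes \<open>B = s I - A\<close> nonnegative, and the row sums of
  \<open>B\<close> are \<open>s\<close> minus positive numbers.\<close>

lemma Z_matrix_positive_row_sums_M_matrix:
  fixes A :: "real Matrix.mat"
  assumes A: "A \<in> carrier_mat n n" and n: "0 < n"
    and offdiag: "\<And>i j. i < n \<Longrightarrow> j < n \<Longrightarrow> i \<noteq> j \<Longrightarrow> A $$ (i, j) \<le> 0"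
    and rows: "\<And>i. i < n \<Longrightarrow> 0 < (\<Sum>j<n. A $$ (i, j))"
  shows "M_matrix A"
proof -
  define s where "s = Max ((\<lambda>i. A $$ (i, i)) ` {..<n})"
  define B where "B = s \<cdot>\<^sub>m 1\<^sub>m n - A"
  have B: "B \<in> carrier_mat n n" using A by (auto simp: B_def intro!: minus_carrier_mat)
  have B_index: "B $$ (i, j) = (if i = j then s else 0) - A $$ (i, j)" if "i < n" "j < n" for i j
    using A that by (simp add: B_def)
  have s: "A $$ (i, i) \<le> s" if "i < n" for i
    using that by (simp add: s_def)
  have nonneg: "0 \<le> B $$ (i, j)" if "i < n" "j < n" for i j
    using s[of i] offdiag[of i j] that by (auto simp: B_index)
  have "(\<Sum>j<n. B $$ (i, j)) \<le> s" if "i < n" for i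
  proof -
    have "(\<Sum>j<n. B $$ (i, j)) = s - (\<Sum>j<n. A $$ (i, j))"
      using that by (simp add: B_index sum_subtractf)
    with rows[OF that] show ?thesis by simp
  qed
  then have "spectral_radius (map_mat complex_of_real B) \<le> s"
    using spectral_radius_le_max_row_sum[OF B n nonneg] by blast
  moreover have "A = s \<cdot>\<^sub>m 1\<^sub>m n - B"
    using A by (intro eq_matI) (auto simp: B_def)
  moreover have "nonneg_entries B"
    using B nonneg by (auto simp: nonneg_entries_def)
  ultimately show ?thesis
    using B unfolding M_matrix_def by blast
qed

section \<open>Geometry of a single square cell\<close>

lemma sum_lessThan_4: "(\<Sum>k<4. g k) = g 0 + g 1 + g 2 + g 3" for g :: "nat \<Rightarrow> 'a::comm_monoid_add"
  by (simp add: eval_nat_numeral ac_simps)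

lemma less_4_cases:
  fixes j :: nat
  assumes "j < 4"
  obtains "j = 0" | "j = 1" | "j = 2" | "j = 3"
  using assms by linarith

lemma cell_eq_Times:
  "cell M i = {fst (corner M i)..fst (corner M i) + side M} \<times> {snd (corner M i)..snd (corner M i) + side M}"
  unfolding cell_def by (cases "corner M i") (simp add: cbox_Pair_eq)

lemma interior_cell_eq_Times:
  "interior (cell M i) =
    {fst (corner M i)<..<fst (corner M i) + side M} \<times> {snd (corner M i)<..<snd (corner M i) + side M}"
  unfolding cell_eq_Times by (simp add: interior_Times interior_atLeastAtMost_real)

lemma interior_cell_nonempty: "0 < side M \<Longrightarrow> interior (cell M i) \<noteq> {}"
  by (simp add: interior_cell_eq_Times)

lemma vertex_in_cell:
  assumes "0 < side M" "k < 4"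
  shows "vertex M i k \<in> cell M i"
  using assms by (elim less_4_cases) (auto simp: cell_eq_Times vertex_def mem_Times_iff)

lemma vertex_notin_interior_cell: "vertex M i k \<notin> interior (cell M i)"
proof (cases "even k")
  case True
  then show ?thesis by (simp add: interior_cell_eq_Times vertex_def mem_Times_iff)
next
  case False
  then have "k mod 2 = 1" by presburger
  then show ?thesis by (simp add: interior_cell_eq_Times vertex_def mem_Times_iff)
qed

lemma at_vertex_within_interior_neq_bot:
  assumes "0 < side M" "k < 4"
  shows "at (vertex M i k) within interior (cell M i) \<noteq> bot"
proof -
  have "closure (interior (cell M i)) = cell M i"
    using convex_closure_interior[of "cell M i"] interior_cell_nonempty[OF assms(1)]
    by (simp add: cell_def)
  moreover have "interior (cell M i) - {vertex M i k} = interior (cell M i)"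
    using vertex_notin_interior_cell by blast
  ultimately show ?thesis
    using vertex_in_cell[OF assms, of i] by (auto simp: at_within_eq_bot_iff)
qed

text \<open>All values that enter the quadrature formulas are one-sided limits at vertices; this rule computes
  them from any continuous expression valid inside the cell.\<close>

lemma cell_trace_eqI:
  assumes "0 < side M" "k < 4"
    and eq: "\<And>y. y \<in> interior (cell M m) \<Longrightarrow> w y = q y"
    and lim: "(q \<longlongrightarrow> l) (at (vertex M m k) within interior (cell M m))"
  shows "cell_trace M m w (vertex M m k) = l"
proof -
  have "(w \<longlongrightarrow> l) (at (vertex M m k) within interior (cell M m))"
    by (rule Lim_transform_within[OF lim, where d = 1]) (simp_all add: eq)
  then show ?thesis
    unfolding cell_trace_def
    by (intro tendsto_Lim at_vertex_within_interior_neq_bot assms)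
qed

lemma grad_eqI:
  assumes "GDERIV w x :> g"
  shows "grad w x = g"
  unfolding grad_def
proof (rule the_equality)
  fix g' assume "GDERIV w x :> g'"
  with assms have "(\<lambda>h. inner h g) = (\<lambda>h. inner h g')"
    unfolding gderiv_def by (rule has_derivative_unique)
  then have "inner (g' - g) g = inner (g' - g) g'" by (rule fun_cong)
  then have "inner (g' - g) (g' - g) = 0" by (simp add: inner_diff_right)
  then show "g' = g" by simp
qed (fact assms)

lemma grad_cong_open:
  assumes "open S" "x \<in> S" "\<And>y. y \<in> S \<Longrightarrow> w y = q y" "GDERIV q x :> g"
  shows "grad w x = g"
  using assms by (intro grad_eqI) (auto simp: gderiv_def intro: has_derivative_transform_within_open)

definition lagrange_grad :: "square_mesh \<Rightarrow> nat \<Rightarrow> nat \<Rightarrow> real \<times> real \<Rightarrow> real \<times> real" where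
  "lagrange_grad M i j x =
     (let v = vertex M i j; u = vertex M i (3 - j)
      in (1 / (fst v - fst u) * ((snd x - snd u) / (snd v - snd u)),
          (fst x - fst u) / (fst v - fst u) * (1 / (snd v - snd u))))"

lemma GDERIV_lagrange: "GDERIV (lagrange M i j) x :> lagrange_grad M i j x"
proof -
  have "((\<lambda>x. (fst x - p) / r * ((snd x - q) / s)) has_derivative
      (\<lambda>h. inner h (1 / r * ((snd x - q) / s), (fst x - p) / r * (1 / s)))) (at x)" for p q r s :: real
    unfolding divide_inverse
    by (auto intro!: derivative_eq_intros simp: fun_eq_iff inner_prod_def algebra_simps)
  then show ?thesis
    unfolding gderiv_def lagrange_grad_def lagrange_def Let_def by simp
qed

lemma isCont_lagrange: "isCont (lagrange M i j) x"
  using GDERIV_lagrange unfolding gderiv_def by (rule has_derivative_continuous)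

lemma isCont_lagrange_grad: "isCont (lagrange_grad M i j) x"
  unfolding lagrange_grad_def Let_def divide_inverse by (intro continuous_intros)

text \<open>The gradient, at vertex \<open>k\<close> of the unit square, of the bilinear Lagrange function of vertex \<open>j\<close>.\<close>

definition ref_grad :: "nat \<Rightarrow> nat \<Rightarrow> real \<times> real" where
  "ref_grad j k =
     (if j div 2 = k div 2 then 2 * real (j mod 2) - 1 else 0,
      if j mod 2 = k mod 2 then 2 * real (j div 2) - 1 else 0)"

lemma lagrange_grad_vertex:
  assumes "side M \<noteq> 0" "j < 4" "k < 4"
  shows "lagrange_grad M i j (vertex M i k) = (1 / side M) *\<^sub>R ref_grad j k"
  using assms(2,3) assms(1)
  by (elim less_4_cases) (simp_all add: lagrange_grad_def vertex_def ref_grad_def Let_def)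

text \<open>The faces of a cell are numbered bottom, right, top, left.  The order of the two end points is
  chosen so that, when two cells meet, equally named ends of a face and of the opposite face of the
  other cell coincide.\<close>

definition face_end1 :: "nat \<Rightarrow> nat" where "face_end1 f = [0, 1, 2, 0] ! f"
definition face_end2 :: "nat \<Rightarrow> nat" where "face_end2 f = [1, 3, 3, 2] ! f"
definition opp_face :: "nat \<Rightarrow> nat" where "opp_face f = [2, 3, 0, 1] ! f"
definition outer_normal :: "nat \<Rightarrow> real \<times> real" where
  "outer_normal f = [(0, -1), (1, 0), (0, 1), (-1, 0)] ! f"

lemmas face_table = face_end1_def face_end2_def opp_face_def outer_normal_def

definition cell_face :: "square_mesh \<Rightarrow> nat \<Rightarrow> nat \<Rightarrow> (real \<times> real) set" where
  "cell_face M i f = closed_segment (vertex M i (face_end1 f)) (vertex M i (face_end2 f))"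

lemma cell_faces_eq: "cell_faces M i = cell_face M i ` {..<4}"
proof -
  have "{..<4::nat} = {0, 1, 2, 3}" by auto
  then show ?thesis by (auto simp: cell_faces_def cell_face_def face_table)
qed

lemma face_ends_less_4: "f < 4 \<Longrightarrow> face_end1 f < 4" "f < 4 \<Longrightarrow> face_end2 f < 4" "f < 4 \<Longrightarrow> opp_face f < 4"
  by (auto elim!: less_4_cases simp: face_table)

lemma cell_face_eq_Times:
  assumes "0 < side M"
  shows "cell_face M i 0 = {fst (corner M i)..fst (corner M i) + side M} \<times> {snd (corner M i)}"
    and "cell_face M i 1 = {fst (corner M i) + side M} \<times> {snd (corner M i)..snd (corner M i) + side M}"
    and "cell_face M i 2 = {fst (corner M i)..fst (corner M i) + side M} \<times> {snd (corner M i) + side M}"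
    and "cell_face M i 3 = {fst (corner M i)} \<times> {snd (corner M i)..snd (corner M i) + side M}"
  using assms
  by (simp_all add: cell_face_def face_table vertex_def closed_segment_same_fst closed_segment_same_snd
      closed_segment_eq_real_ivl)

lemma extreme_points_cell_face:
  "{x. x extreme_point_of cell_face M i f} = {vertex M i (face_end1 f), vertex M i (face_end2 f)}"
  by (auto simp: cell_face_def extreme_point_of_segment)

lemma vertex_inj:
  assumes "0 < side M" "j < 4" "k < 4" "vertex M i j = vertex M i k"
  shows "j = k"
  using assms(2,3,4) assms(1) by (elim less_4_cases) (simp_all add: vertex_def)

lemma quad_face_cell_face:
  assumes "0 < side M" "f < 4"
  shows "quad_face M (cell_face M i f) w =
    side M / 2 * w (vertex M i (face_end1 f)) + side M / 2 * w (vertex M i (face_end2 f))"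
proof -
  have "vertex M i (face_end1 f) \<noteq> vertex M i (face_end2 f)"
    using vertex_inj[OF assms(1) face_ends_less_4(1,2)[OF assms(2)]] assms(2)
    by (auto elim!: less_4_cases simp: face_table)
  then show ?thesis
    by (simp add: quad_face_def extreme_points_cell_face)
qed

lemma cell_face_disjoint_interior:
  assumes "0 < side M" "f < 4"
  shows "cell_face M i f \<inter> interior (cell M i) = {}"
  using assms(2) by (elim less_4_cases) (auto simp: cell_face_eq_Times[OF assms(1)] interior_cell_eq_Times simp del: One_nat_def)

text \<open>Testing the supporting half plane with the vertices alone already pins down the normal: the
  tangential component vanishes by comparing the two ends of the face, and the sign of the other one
  is fixed by the remaining vertices.\<close>

lemma face_normal_cell_face:
  assumes s: "0 < side M" and f: "f < 4" and minus: "face_minus M (cell_face M m f) = m"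
  shows "face_normal M (cell_face M m f) = outer_normal f"
proof -
  obtain a b where ab: "corner M m = (a, b)" by (cases "corner M m") auto
  have *: "(norm n = 1 \<and> (\<forall>x\<in>cell_face M m f. \<forall>y\<in>cell M m. inner n (y - x) \<le> 0)) \<longleftrightarrow> n = outer_normal f"
    (is "?P n \<longleftrightarrow> _") for n :: "real \<times> real"
  proof
    assume P: "?P n"
    obtain p q where n: "n = (p, q)" by (cases n)
    have nn: "p\<^sup>2 + q\<^sup>2 = 1"
      using P by (simp add: n norm_Pair)
    have ineq: "inner n (vertex M m k - vertex M m e) \<le> 0"
      if "k < 4" "e = face_end1 f \<or> e = face_end2 f" for k e
      using P vertex_in_cell[OF s that(1)] that(2) by (auto simp: cell_face_def)
    have ineqs: "inner n (vertex M m k - vertex M m (face_end1 f)) \<le> 0"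
      "inner n (vertex M m k - vertex M m (face_end2 f)) \<le> 0" if "k < 4" for k
      using ineq that by auto
    show "n = outer_normal f"
      using f ineqs[of 0] ineqs[of 1] ineqs[of 2] ineqs[of 3] nn s
      by (elim less_4_cases)
        (auto simp: n ab face_table vertex_def mult_le_0_iff zero_le_mult_iff power2_eq_1_iff)
  next
    assume "n = outer_normal f"
    then show "?P n"
      using f s by (elim less_4_cases)
        (auto simp: face_table cell_face_eq_Times cell_eq_Times norm_Pair inner_prod_def simp del: One_nat_def)
  qed
  then show ?thesis
    unfolding face_normal_def minus by simp
qed

section \<open>Traces of the basis functions and cell terms\<close>

locale conforming_square_mesh =
  fixes M :: square_mesh
  assumes conforming: "conforming_mesh M"
begin

lemma side_pos: "0 < side M" and n_el_pos: "0 < n_el M"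
  using conforming by (auto simp: conforming_mesh_def)

text \<open>Conformity enters through this fact: a common vertex or face of two cells lies on their boundaries,
  so cells do not overlap.\<close>

lemma cell_Int_disjoint_interior:
  assumes "i < n_el M" "j < n_el M" "i \<noteq> j"
  shows "cell M i \<inter> cell M j \<inter> interior (cell M i) = {}"
proof -
  consider "cell M i \<inter> cell M j = {}"
    | v where "v \<in> cell_vertices M i" "cell M i \<inter> cell M j = {v}"
    | "cell M i \<inter> cell M j \<in> cell_faces M i"
    using conforming assms unfolding conforming_mesh_def by blast
  then show ?thesis
  proof cases
    case 2
    then show ?thesis using vertex_notin_interior_cell by (auto simp: cell_vertices_def)
  next
    case 3
    then show ?thesis using cell_face_disjoint_interior[OF side_pos] by (auto simp: cell_faces_eq)
  qed simp
qed

lemma interior_cell_notin_other: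
  assumes "i < n_el M" "j < n_el M" "i \<noteq> j" "y \<in> interior (cell M i)"
  shows "y \<notin> cell M j"
  using cell_Int_disjoint_interior[OF assms(1-3)] assms(4) interior_subset[of "cell M i"] by blast

lemma corner_inj:
  assumes "i < n_el M" "j < n_el M" "corner M i = corner M j"
  shows "i = j"
proof (rule ccontr)
  assume "i \<noteq> j"
  moreover obtain y where "y \<in> interior (cell M i)"
    using interior_cell_nonempty[OF side_pos] by blast
  moreover have "cell M i = cell M j" using assms(3) by (simp add: cell_def)
  ultimately show False
    using interior_cell_notin_other[OF assms(1,2)] interior_subset by blast
qed

lemma basis_fun_interior:
  assumes "i < n_el M" "m < n_el M" "y \<in> interior (cell M m)"
  shows "basis_fun M i j y = (if m = i then lagrange M i j y else 0)"
  using interior_cell_notin_other[of m i y] assms interior_subset[of "cell M m"]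
  by (auto simp: basis_fun_def)

lemma grad_basis_fun_interior:
  assumes "i < n_el M" "m < n_el M" "y \<in> interior (cell M m)"
  shows "grad (basis_fun M i j) y = (if m = i then lagrange_grad M i j y else 0)"
proof (rule grad_cong_open[OF open_interior assms(3) basis_fun_interior[OF assms(1,2)]])
  show "GDERIV (\<lambda>y. if m = i then lagrange M i j y else 0) y :> (if m = i then lagrange_grad M i j y else 0)"
    by (cases "m = i") (simp_all add: GDERIV_lagrange GDERIV_const)
qed

lemma tendsto_basis_fun_vertex:
  assumes "j < 4" "k < 4"
  shows "((\<lambda>y. if m = i then lagrange M i j y else 0) \<longlongrightarrow> (if m = i \<and> k = j then 1 else 0))
    (at (vertex M m k) within interior (cell M m))"
proof (cases "m = i")
  case True
  have "(lagrange M i j \<longlongrightarrow> lagrange M i j (vertex M m k)) (at (vertex M m k) within interior (cell M m))"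
    using isCont_lagrange unfolding isCont_def by (rule tendsto_within_subset) simp
  then show ?thesis
    using True side_pos assms by (simp add: lagrange_vertex)
qed simp

lemma cell_trace_basis_fun:
  assumes "i < n_el M" "m < n_el M" "j < 4" "k < 4"
  shows "cell_trace M m (basis_fun M i j) (vertex M m k) = (if m = i \<and> k = j then 1 else 0)"
  by (rule cell_trace_eqI[OF side_pos assms(4) basis_fun_interior[OF assms(1,2)]
        tendsto_basis_fun_vertex[OF assms(3,4)]])

definition basis_grad :: "nat \<Rightarrow> nat \<Rightarrow> nat \<Rightarrow> nat \<Rightarrow> real \<times> real" where
  "basis_grad i j m k = (if m = i then (1 / side M) *\<^sub>R ref_grad j k else 0)"

lemma cell_trace_grad_basis_fun:
  assumes "i < n_el M" "i' < n_el M" "m < n_el M" "j < 4" "j' < 4" "k < 4"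
  shows "cell_trace M m (\<lambda>y. inner (grad (basis_fun M i j) y) n) (vertex M m k)
      = inner (basis_grad i j m k) n" (is ?A)
    and "cell_trace M m (\<lambda>y. inner (grad (basis_fun M i j) y) (grad (basis_fun M i' j') y)) (vertex M m k)
      = inner (basis_grad i j m k) (basis_grad i' j' m k)" (is ?B)
proof -
  have lim: "((\<lambda>y. if m = i then lagrange_grad M i j y else 0) \<longlongrightarrow> basis_grad i j m k)
      (at (vertex M m k) within interior (cell M m))" if "j < 4" for i j
  proof (cases "m = i")
    case True
    have "(lagrange_grad M i j \<longlongrightarrow> lagrange_grad M i j (vertex M m k))
        (at (vertex M m k) within interior (cell M m))"
      using isCont_lagrange_grad unfolding isCont_def by (rule tendsto_within_subset) simp
    then show ?thesis
      using True side_pos that assms(6) by (simp add: lagrange_grad_vertex basis_grad_def)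
  qed (simp add: basis_grad_def)
  show ?A
    by (rule cell_trace_eqI[OF side_pos assms(6) _ tendsto_inner[OF lim[OF assms(4)] tendsto_const]])
      (simp add: grad_basis_fun_interior[OF assms(1,3)])
  show ?B
    by (rule cell_trace_eqI[OF side_pos assms(6) _
          tendsto_inner[OF lim[OF assms(4), of i] lim[OF assms(5), of i']]])
      (simp add: grad_basis_fun_interior[OF assms(1,3)] grad_basis_fun_interior[OF assms(2,3)])
qed

text \<open>Mass lumping: seen from inside a cell, only one basis function is nonzero at a given vertex of that
  cell, so the mass matrix is diagonal.\<close>

lemma mass_entry:
  assumes \<rho>: "\<rho> \<in> dg_space M" and "i < n_el M" "i' < n_el M" "j < 4" "j' < 4"
  shows "discrete_inner M (\<lambda>x. \<rho> x * basis_fun M i j x) (basis_fun M i' j') =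
    (if i = i' \<and> j = j' then (side M)\<^sup>2 / 4 * cell_trace M i \<rho> (vertex M i j) else 0)"
proof -
  have "cell_trace M m (\<lambda>x. \<rho> x * basis_fun M i j x * basis_fun M i' j' x) (vertex M m k)
      = (if m = i \<and> k = j \<and> i = i' \<and> j = j' then cell_trace M i \<rho> (vertex M i j) else 0)"
    if m: "m < n_el M" and k: "k < 4" for m k
  proof -
    let ?at = "at (vertex M m k) within interior (cell M m)"
    obtain q where q: "q \<in> Q1" "\<And>x. x \<in> interior (cell M m) \<Longrightarrow> \<rho> x = q x"
      using \<rho> m unfolding dg_space_def by blast
    have "isCont q x" for x
    proof -
      from q(1) obtain a b c d where "\<And>x y. q (x, y) = a + b * x + c * y + d * x * y"
        unfolding Q1_def by blast
      then have "q = (\<lambda>z. a + b * fst z + c * snd z + d * fst z * snd z)"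
        by (simp add: fun_eq_iff split: prod.split)
      moreover have "isCont (\<lambda>z::real \<times> real. a + b * fst z + c * snd z + d * fst z * snd z) x"
        by (intro continuous_intros)
      ultimately show ?thesis by simp
    qed
    then have q_lim: "(q \<longlongrightarrow> q (vertex M m k)) ?at"
      by (meson continuous_at_imp_continuous_at_within continuous_within)
    have q_trace: "cell_trace M m \<rho> (vertex M m k) = q (vertex M m k)"
      by (rule cell_trace_eqI[OF side_pos k q(2) q_lim])
    have "cell_trace M m (\<lambda>x. \<rho> x * basis_fun M i j x * basis_fun M i' j' x) (vertex M m k)
        = q (vertex M m k) * (if m = i \<and> k = j then 1 else 0) * (if m = i' \<and> k = j' then 1 else 0)"
      by (rule cell_trace_eqI[OF side_pos k _
            tendsto_mult[OF tendsto_mult[OF q_lim tendsto_basis_fun_vertex[OF assms(4) k]]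
              tendsto_basis_fun_vertex[OF assms(5) k]]])
        (simp add: basis_fun_interior[OF assms(2) m] basis_fun_interior[OF assms(3) m] q(2))
    also have "\<dots> = (if m = i \<and> k = j \<and> i = i' \<and> j = j'
        then cell_trace M i \<rho> (vertex M i j) else 0)"
      by (simp flip: q_trace)
    finally show ?thesis .
  qed
  then have "discrete_inner M (\<lambda>x. \<rho> x * basis_fun M i j x) (basis_fun M i' j') =
      (\<Sum>m<n_el M. \<Sum>k<4. if m = i then if k = j then if i = i' \<and> j = j'
        then (side M)\<^sup>2 / 4 * cell_trace M i \<rho> (vertex M i j) else 0 else 0 else 0)"
    unfolding discrete_inner_def quad_cell_def by (intro sum.cong) auto
  also have "\<dots> = (\<Sum>m<n_el M. if m = i then \<Sum>k<4. if k = j then if i = i' \<and> j = j'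
        then (side M)\<^sup>2 / 4 * cell_trace M i \<rho> (vertex M i j) else 0 else 0 else 0)"
    by (intro sum.cong) auto
  finally show ?thesis using assms by simp
qed

definition "stiffness_term i j i' j' =
  (\<Sum>m<n_el M. quad_cell M m (\<lambda>x. inner (grad (basis_fun M i j) x) (grad (basis_fun M i' j') x)))"

lemma stiffness_term_eq:
  assumes "i < n_el M" "i' < n_el M" "j < 4" "j' < 4"
  shows "stiffness_term i j i' j' =
    (if i = i' then (\<Sum>k<4. inner (ref_grad j k) (ref_grad j' k)) / 4 else 0)"
proof -
  have "quad_cell M m (\<lambda>x. inner (grad (basis_fun M i j) x) (grad (basis_fun M i' j') x)) =
      (if m = i then if i = i' then (\<Sum>k<4. inner (ref_grad j k) (ref_grad j' k)) / 4 else 0 else 0)"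
    if m: "m < n_el M" for m
  proof -
    have "(side M)\<^sup>2 / 4 * inner (basis_grad i j m k) (basis_grad i' j' m k) =
        (if m = i then if i = i' then inner (ref_grad j k) (ref_grad j' k) / 4 else 0 else 0)" for k
      using side_pos by (simp add: basis_grad_def power2_eq_square)
    then have "quad_cell M m (\<lambda>x. inner (grad (basis_fun M i j) x) (grad (basis_fun M i' j') x)) =
        (\<Sum>k<4. if m = i then if i = i' then inner (ref_grad j k) (ref_grad j' k) / 4 else 0 else 0)"
      unfolding quad_cell_def
      by (intro sum.cong) (simp_all add: cell_trace_grad_basis_fun(2) assms m)
    then show ?thesis by (simp add: sum_divide_distrib)
  qed
  then have "stiffness_term i j i' j' = (\<Sum>m<n_el M. if m = i then if i = i'
      then (\<Sum>k<4. inner (ref_grad j k) (ref_grad j' k)) / 4 else 0 else 0)"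
    unfolding stiffness_term_def by (intro sum.cong) simp_all
  then show ?thesis using assms by simp
qed

subsection \<open>The cells at a face\<close>

text \<open>The cells between which jumps and averages on a face are formed.\<close>

definition "cells_at F = {i. i < n_el M \<and> F \<in> cell_faces M i}"

lemma finite_cells_at: "finite (cells_at F)"
  unfolding cells_at_def by simp

lemma face_minus_plus_eq: "face_minus M F = Min (cells_at F)" "face_plus M F = Max (cells_at F)"
  by (simp_all add: cells_at_def face_minus_def face_plus_def)

text \<open>Two cells sharing a face in the same position would have the same corner, hence be equal; a
  horizontal segment is not a vertical one.  Only opposite positions remain.\<close>

lemma cell_face_eq_imp:
  assumes "m < n_el M" "p < n_el M" "m \<noteq> p" "f < 4" "g < 4" "cell_face M m f = cell_face M p g"
  shows "g = opp_face f"
    "vertex M p (face_end1 (opp_face f)) = vertex M m (face_end1 f)"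
    "vertex M p (face_end2 (opp_face f)) = vertex M m (face_end2 f)"
proof -
  obtain a b a' b' where corners: "corner M m = (a, b)" "corner M p = (a', b')"
    by (meson surj_pair)
  have "a \<noteq> a' \<or> b \<noteq> b'"
    using corner_inj[OF assms(1,2)] assms(3) corners by auto
  moreover have ends: "{vertex M m (face_end1 f), vertex M m (face_end2 f)} =
      {vertex M p (face_end1 g), vertex M p (face_end2 g)}"
    using assms(6) by (metis extreme_points_cell_face)
  ultimately have "g = opp_face f \<and>
      vertex M p (face_end1 (opp_face f)) = vertex M m (face_end1 f) \<and>
      vertex M p (face_end2 (opp_face f)) = vertex M m (face_end2 f)"
    using assms(4,5) side_pos
    by (elim less_4_cases) (simp_all add: face_table vertex_def doubleton_eq_iff corners, argo+)
  then show "g = opp_face f"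
    "vertex M p (face_end1 (opp_face f)) = vertex M m (face_end1 f)"
    "vertex M p (face_end2 (opp_face f)) = vertex M m (face_end2 f)" by auto
qed

lemma interior_face_cases:
  assumes "F \<in> interior_faces M"
  obtains m p f where "m < n_el M" "p < n_el M" "m \<noteq> p" "f < 4"
    "F = cell_face M m f" "F = cell_face M p (opp_face f)" "face_minus M F = m" "face_plus M F = p"
    "vertex M p (face_end1 (opp_face f)) = vertex M m (face_end1 f)"
    "vertex M p (face_end2 (opp_face f)) = vertex M m (face_end2 f)"
    "face_normal M F = outer_normal f"
proof -
  obtain i j where ij: "i < j" "i \<in> cells_at F" "j \<in> cells_at F"
    using assms unfolding interior_faces_def cells_at_def by auto
  define m p where "m = Min (cells_at F)" and "p = Max (cells_at F)"
  have "m \<in> cells_at F" "p \<in> cells_at F"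
    using ij finite_cells_at unfolding m_def p_def by (auto intro!: Min_in Max_in)
  then obtain f g where fg: "f < 4" "F = cell_face M m f" "g < 4" "F = cell_face M p g"
    and mp: "m < n_el M" "p < n_el M"
    unfolding cells_at_def cell_faces_eq by auto
  have "m \<le> i" "j \<le> p"
    using ij finite_cells_at unfolding m_def p_def by auto
  with ij have ne: "m \<noteq> p" by simp
  have minus: "face_minus M F = m" "face_plus M F = p"
    by (simp_all add: face_minus_plus_eq m_def p_def)
  have nrm: "face_normal M F = outer_normal f"
    using face_normal_cell_face[OF side_pos fg(1)] fg(2) minus by metis
  note eqs = cell_face_eq_imp[OF mp ne fg(1,3)] 
  show thesis
    using that[OF mp ne fg(1,2) _ minus _ _ nrm] eqs fg(2,4) by simp
qed

text \<open>A face of the mesh that is not interior belongs to a single cell, since the cells at a face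
  are totally ordered by their numbers; in particular this holds for Dirichlet faces outside
  \<open>interior_faces\<close>.\<close>

lemma noninterior_face_cases:
  assumes "F \<in> mesh_faces M" "F \<notin> interior_faces M"
  obtains m f where "m < n_el M" "f < 4" "F = cell_face M m f"
    "face_minus M F = m" "face_normal M F = outer_normal f"
proof -
  obtain m where m: "m \<in> cells_at F"
    using assms(1) unfolding mesh_faces_def cells_at_def by auto
  have "cells_at F = {m}"
  proof (intro equalityI subsetI)
    fix i assume "i \<in> cells_at F"
    with m assms(2) have "\<not> i < m" "\<not> m < i"
      unfolding interior_faces_def cells_at_def by auto
    then show "i \<in> {m}" by simp
  qed (use m in simp)
  then have minus: "face_minus M F = m" by (simp add: face_minus_plus_eq)
  from m obtain f where f: "m < n_el M" "f < 4" "F = cell_face M m f"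
    unfolding cells_at_def cell_faces_eq by auto
  then show thesis
    using that minus face_normal_cell_face[OF side_pos f(2)] by metis
qed

lemma finite_mesh_faces: "finite (mesh_faces M)"
  by (simp add: mesh_faces_def cell_faces_def)

lemma interior_faces_subset: "interior_faces M \<subseteq> mesh_faces M"
  unfolding interior_faces_def mesh_faces_def by force

end

section \<open>Contribution of one end of a face\<close>

text \<open>The other end of the edge that starts at vertex \<open>e\<close> perpendicularly to face \<open>f\<close>.\<close>

definition neighbour :: "nat \<Rightarrow> nat \<Rightarrow> nat" where
  "neighbour f e = (if even f then (e + 2) mod 4 else if even e then e + 1 else e - 1)"

text \<open>Opposite vertices of a cell have numbers with sum \<open>3\<close>.\<close>

definition adjacent :: "nat \<Rightarrow> nat \<Rightarrow> bool" where
  "adjacent j j' \<longleftrightarrow> j \<noteq> j' \<and> j + j' \<noteq> 3"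

text \<open>For adjacent vertices, the face through \<open>j'\<close> perpendicular to the edge from \<open>j'\<close> to \<open>j\<close>.  It is
  the only face on which the consistency term between these two vertices of a cell is positive.\<close>

definition away_face :: "nat \<Rightarrow> nat \<Rightarrow> nat" where
  "away_face j j' =
    (if j div 2 = j' div 2 then if even j' then 3 else 1 else if j' div 2 = 0 then 0 else 2)"

definition face_end :: "nat \<Rightarrow> nat \<Rightarrow> bool" where
  "face_end f e \<longleftrightarrow> e = face_end1 f \<or> e = face_end2 f"

text \<open>The outward derivative at \<open>e\<close> is a difference quotient along the edge perpendicular to the face, so
  it sees only the nodal values at \<open>e\<close> and at its neighbour inside the cell.\<close>

lemma normal_derivative:
  assumes "f < 4" "j < 4" "face_end f e"
  shows "inner (ref_grad j e) (outer_normal f) = (if j = e then 1 else if j = neighbour f e then -1 else 0)"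
  using assms unfolding face_end_def
  by (elim less_4_cases disjE) (simp_all add: face_table ref_grad_def neighbour_def)

lemma outer_normal_opp_face: "f < 4 \<Longrightarrow> outer_normal (opp_face f) = - outer_normal f"
  by (elim less_4_cases) (simp_all add: face_table)

lemma neighbour_away_face:
  assumes "f < 4" "face_end f e" "j = neighbour f e"
  shows "adjacent j e" "f = away_face j e"
  using assms unfolding face_end_def
  by (auto elim!: less_4_cases simp: face_table neighbour_def adjacent_def away_face_def)

text \<open>The Lagrange functions of a cell sum to the constant \<open>1\<close>.\<close>

lemma sum_ref_grad:
  assumes "k < 4"
  shows "(\<Sum>j<4. ref_grad j k) = 0"
  using assms by (elim less_4_cases) (simp_all add: sum_lessThan_4 ref_grad_def zero_prod_def)

lemma ref_stiffness:
  assumes "j < 4" "j' < 4" "j \<noteq> j'"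
  shows "(\<Sum>k<4. inner (ref_grad j k) (ref_grad j' k)) = (if adjacent j j' then - 2 else 0)"
  using assms by (elim less_4_cases) (simp_all add: sum_lessThan_4 ref_grad_def adjacent_def)

text \<open>Traces of the basis function \<open>(i, j)\<close>, and of its derivative along the outward normal of face \<open>f\<close>
  scaled by the side length, taken from inside cell \<open>m\<close> at its vertex \<open>e\<close>.\<close>

definition side_value :: "nat \<Rightarrow> nat \<Rightarrow> nat \<Rightarrow> nat \<Rightarrow> real" where
  "side_value m e i j = (if m = i \<and> e = j then 1 else 0)"

definition side_flux :: "nat \<Rightarrow> nat \<Rightarrow> nat \<Rightarrow> nat \<Rightarrow> nat \<Rightarrow> real" where
  "side_flux f m e i j = (if m = i then inner (ref_grad j e) (outer_normal f) else 0)"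

text \<open>Consistency and penalty contribution of one end of an interior face, seen as vertex \<open>e\<close> of cell
  \<open>m\<close> and as vertex \<open>e'\<close> of cell \<open>p\<close>.  The flux of the second cell has a minus sign because its outward
  normal is opposite to that of the first cell.  The factor \<open>1/4\<close> is the average \<open>1/2\<close> times the
  quadrature weight \<open>1/2\<close>; the powers of the side length cancel.  The constant \<open>c\<close> stands for
  \<open>\<sigma> / (2 * sqrt 2)\<close>.\<close>

definition interior_node_term where
  "interior_node_term c f m e p e' i j i' j' =
    - 1/4 * (side_flux f m e i j - side_flux (opp_face f) p e' i j) * (side_value m e i' j' - side_value p e' i' j')
    + c * (side_value m e i j - side_value p e' i j) * (side_value m e i' j' - side_value p e' i' j')"

definition boundary_node_term where
  "boundary_node_term c f m e i j i' j' =
    - 1/2 * side_flux f m e i j * side_value m e i' j' + c * side_value m e i j * side_value m e i' j'"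

text \<open>If the test function lives in the cell on one side, its jump times the normal points out of that
  cell, so the two sides are symmetric.  A trial function in the same cell contributes \<open>1/4\<close> from the
  neighbouring vertex and nothing from the others; one in the opposite cell contributes \<open>1/4 - c\<close> from the common
  vertex and \<open>-1/4\<close> from the neighbouring one.  This is where the bound on the penalty is needed.\<close>

lemma interior_node_term_le:
  assumes "1/4 < c" "f < 4" "j < 4" "j' < 4" "m \<noteq> p"
    and "face_end f e" "face_end (opp_face f) e'" "(i, j) \<noteq> (i', j')"
  shows "interior_node_term c f m e p e' i j i' j' \<le>
    (if i = i' \<and> adjacent j j' \<and>
        (i' = m \<and> f = away_face j j' \<or> i' = p \<and> opp_face f = away_face j j') then 1/4 else 0)"
    (is "_ \<le> ?bound")
proof -
  have flux: "side_flux f m e i j = (if m = i then if j = e then 1 else if j = neighbour f e then - 1 else 0 else 0)"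
    "side_flux (opp_face f) p e' i j =
      (if p = i then if j = e' then 1 else if j = neighbour (opp_face f) e' then - 1 else 0 else 0)"
    using assms(2,3,6,7) by (simp_all add: side_flux_def normal_derivative face_ends_less_4)
  have bound: "0 \<le> ?bound" by simp
  consider "i' = m" "j' = e" | "i' = p" "j' = e'" | "\<not> (i' = m \<and> j' = e)" "\<not> (i' = p \<and> j' = e')" by blast
  then show ?thesis
  proof cases
    case 1
    then have "interior_node_term c f m e p e' i j i' j' \<le>
        (if i = i' \<and> j = neighbour f e then 1/4 else 0)"
      using assms(1,5,8)
      by (auto simp: interior_node_term_def side_value_def flux)
    also have "\<dots> \<le> ?bound"
      using 1 neighbour_away_face[OF assms(2,6)] by auto
    finally show ?thesis .
  next
    case 2
    then have "interior_node_term c f m e p e' i j i' j' \<le>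
        (if i = i' \<and> j = neighbour (opp_face f) e' then 1/4 else 0)"
      using assms(1,5,8)
      by (auto simp: interior_node_term_def side_value_def flux)
    also have "\<dots> \<le> ?bound"
      using 2 neighbour_away_face[OF face_ends_less_4(3)[OF assms(2)] assms(7)] by auto
    finally show ?thesis .
  next
    case 3
    then have "interior_node_term c f m e p e' i j i' j' = 0"
      by (auto simp: interior_node_term_def side_value_def)
    with bound show ?thesis by linarith
  qed
qed

text \<open>On a Dirichlet face the average has weight \<open>1\<close>, which doubles the critical contribution; the
  penalty couples a basis function only with itself.\<close>

lemma boundary_node_term_le:
  assumes "f < 4" "j < 4" "j' < 4" "face_end f e" "(i, j) \<noteq> (i', j')"
  shows "boundary_node_term c f m e i j i' j' \<le>
    (if i = i' \<and> adjacent j j' \<and> i' = m \<and> f = away_face j j' \<and> j' = e then 1/2 else 0)"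
proof -
  have "side_flux f m e i j = (if m = i then if j = e then 1 else if j = neighbour f e then - 1 else 0 else 0)"
    using assms(1,2,4) by (simp add: side_flux_def normal_derivative)
  then show ?thesis
    using assms(5) neighbour_away_face[OF assms(1,4), of j]
    by (auto simp: boundary_node_term_def side_value_def)
qed

lemma sum_side_value:
  assumes "m < n" "e < 4"
  shows "(\<Sum>i<n. \<Sum>j<4. side_value m e i j) = 1"
proof -
  have "(\<Sum>j<4. side_value m e i j) = (if m = i then 1 else 0)" for i
    using assms(2) by (simp add: side_value_def)
  with assms(1) show ?thesis by simp
qed

lemma sum_side_flux:
  assumes "m < n" "e < 4"
  shows "(\<Sum>i<n. \<Sum>j<4. side_flux f m e i j) = 0"
proof (rule sum.neutral, rule ballI)
  fix i
  show "(\<Sum>j<4. side_flux f m e i j) = 0"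
    using sum_ref_grad[OF assms(2)]
    by (cases "m = i") (simp_all add: side_flux_def flip: inner_sum_left)
qed

text \<open>The constant \<open>1\<close> has neither flux nor jump across an interior face.\<close>

lemma sum_interior_node_term:
  assumes "m < n" "p < n" "e < 4" "e' < 4"
  shows "(\<Sum>i<n. \<Sum>j<4. interior_node_term c f m e p e' i j i' j') = 0"
proof -
  let ?J = "side_value m e i' j' - side_value p e' i' j'"
  have "(\<Sum>i<n. \<Sum>j<4. interior_node_term c f m e p e' i j i' j') =
      - 1/4 * ((\<Sum>i<n. \<Sum>j<4. side_flux f m e i j) - (\<Sum>i<n. \<Sum>j<4. side_flux (opp_face f) p e' i j)) * ?J
      + c * ((\<Sum>i<n. \<Sum>j<4. side_value m e i j) - (\<Sum>i<n. \<Sum>j<4. side_value p e' i j)) * ?J"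
    unfolding interior_node_term_def sum.distrib sum_distrib_left[symmetric] sum_distrib_right[symmetric]
      sum_subtractf ..
  then show ?thesis
    using assms by (simp add: sum_side_value sum_side_flux)
qed

lemma sum_boundary_node_term:
  assumes "m < n" "e < 4"
  shows "(\<Sum>i<n. \<Sum>j<4. boundary_node_term c f m e i j i' j') = c * side_value m e i' j'"
proof -
  have "(\<Sum>i<n. \<Sum>j<4. boundary_node_term c f m e i j i' j') =
      - 1/2 * (\<Sum>i<n. \<Sum>j<4. side_flux f m e i j) * side_value m e i' j'
      + c * (\<Sum>i<n. \<Sum>j<4. side_value m e i j) * side_value m e i' j'"
    unfolding boundary_node_term_def sum.distrib sum_distrib_left[symmetric] sum_distrib_right[symmetric] ..
  then show ?thesis
    using assms by (simp add: sum_side_value sum_side_flux)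
qed

section \<open>Signs of the entries of the diffusion matrix\<close>

context conforming_square_mesh
begin

definition face_term :: "real \<Rightarrow> (real \<times> real) set \<Rightarrow> nat \<Rightarrow> nat \<Rightarrow> nat \<Rightarrow> nat \<Rightarrow> real" where
  "face_term \<sigma> F i j i' j' =
    - quad_face M F (\<lambda>x. average M F (\<lambda>y. inner (grad (basis_fun M i j) y) (face_normal M F)) x
        * jump M F (basis_fun M i' j') x)
    + \<sigma> / mesh_size M * quad_face M F (\<lambda>x. jump M F (basis_fun M i j) x * jump M F (basis_fun M i' j') x)"

lemma iipg_form_basis_fun:
  "iipg_form M FD \<sigma> (basis_fun M i j) (basis_fun M i' j') =
    stiffness_term i j i' j' + (\<Sum>F\<in>interior_faces M \<union> FD. face_term \<sigma> F i j i' j')"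
  unfolding iipg_form_def stiffness_term_def face_term_def
  by (simp add: sum.distrib sum_negf sum_subtractf sum_distrib_left)

lemma cell_trace_basis_fun_side_value:
  assumes "i < n_el M" "m < n_el M" "j < 4" "k < 4"
  shows "cell_trace M m (basis_fun M i j) (vertex M m k) = side_value m k i j"
  using cell_trace_basis_fun[OF assms] by (simp add: side_value_def)

lemma cell_trace_grad_side_flux:
  assumes "i < n_el M" "m < n_el M" "j < 4" "k < 4"
  shows "cell_trace M m (\<lambda>y. inner (grad (basis_fun M i j) y) (outer_normal f)) (vertex M m k)
    = side_flux f m k i j / side M"
  using cell_trace_grad_basis_fun(1)[OF assms(1) assms(1) assms(2,3,3,4)]
  by (simp add: basis_grad_def side_flux_def)

text \<open>The penalty is scaled by the diagonal rather than the side, hence the factor \<open>sqrt 2\<close> that reappears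
  in the threshold for \<open>\<sigma>\<close>.\<close>

lemma penalty_scaling: "\<sigma> / mesh_size M * (side M / 2 * t) = \<sigma> / (2 * sqrt 2) * t"
  using side_pos by (simp add: mesh_size_def)

lemma interior_face_term:
  assumes "F \<in> interior_faces M"
  obtains m p f where "m < n_el M" "p < n_el M" "m \<noteq> p" "f < 4"
    "F = cell_face M m f" "F = cell_face M p (opp_face f)"
    "\<forall>i<n_el M. \<forall>j<4. \<forall>i'<n_el M. \<forall>j'<4. face_term \<sigma> F i j i' j' =
      interior_node_term (\<sigma> / (2 * sqrt 2)) f m (face_end1 f) p (face_end1 (opp_face f)) i j i' j' +
      interior_node_term (\<sigma> / (2 * sqrt 2)) f m (face_end2 f) p (face_end2 (opp_face f)) i j i' j'"
proof -
  obtain m p f where mp: "m < n_el M" "p < n_el M" "m \<noteq> p" and f: "f < 4"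
    and F: "F = cell_face M m f" "F = cell_face M p (opp_face f)"
    and sides: "face_minus M F = m" "face_plus M F = p"
    and ends: "vertex M p (face_end1 (opp_face f)) = vertex M m (face_end1 f)"
      "vertex M p (face_end2 (opp_face f)) = vertex M m (face_end2 f)"
    and nrm: "face_normal M F = outer_normal f"
    using interior_face_cases[OF assms] by metis
  have "face_term \<sigma> F i j i' j' =
      interior_node_term (\<sigma> / (2 * sqrt 2)) f m (face_end1 f) p (face_end1 (opp_face f)) i j i' j' +
      interior_node_term (\<sigma> / (2 * sqrt 2)) f m (face_end2 f) p (face_end2 (opp_face f)) i j i' j'"
    if ij: "i < n_el M" "j < 4" "i' < n_el M" "j' < 4" for i j i' j'
  proof -
    have lt: "face_end1 f < 4" "face_end2 f < 4" "face_end1 (opp_face f) < 4" "face_end2 (opp_face f) < 4"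
      using f by (auto intro: face_ends_less_4)
    have jmp: "jump M F (basis_fun M i j) (vertex M m e) = side_value m e i j - side_value p e' i j"
      if "vertex M p e' = vertex M m e" "e < 4" "e' < 4" "i < n_el M" "j < 4" for e e' i j
      using cell_trace_basis_fun_side_value[OF that(4) mp(1) that(5,2)]
        cell_trace_basis_fun_side_value[OF that(4) mp(2) that(5,3)] assms
      by (simp add: jump_def sides that(1))
    have avg: "average M F (\<lambda>y. inner (grad (basis_fun M i j) y) (outer_normal f)) (vertex M m e)
        = 1/2 * (side_flux f m e i j - side_flux (opp_face f) p e' i j) / side M"
      if "vertex M p e' = vertex M m e" "e < 4" "e' < 4" for e e'
    proof -
      have "side_flux f p e' i j = - side_flux (opp_face f) p e' i j"
        by (simp add: side_flux_def outer_normal_opp_face[OF f])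
      then show ?thesis
        using cell_trace_grad_side_flux[OF ij(1) mp(1) ij(2) that(2), of f]
          cell_trace_grad_side_flux[OF ij(1) mp(2) ij(2) that(3), of f] assms
        by (simp add: average_def sides that(1) diff_divide_distrib)
    qed
    have node: "- (side M / 2 * (1/2 * (side_flux f m e i j - side_flux (opp_face f) p e' i j) / side M
          * (side_value m e i' j' - side_value p e' i' j')))
        + \<sigma> / mesh_size M * (side M / 2 * ((side_value m e i j - side_value p e' i j)
          * (side_value m e i' j' - side_value p e' i' j')))
        = interior_node_term (\<sigma> / (2 * sqrt 2)) f m e p e' i j i' j'" for e e'
      unfolding penalty_scaling interior_node_term_def using side_pos by simp
    show ?thesis
      unfolding face_term_def nrm
      unfolding F(1) quad_face_cell_face[OF side_pos f] unfolding F(1)[symmetric]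
      by (simp add: jmp[OF ends(1) lt(1,3)] jmp[OF ends(2) lt(2,4)] avg[OF ends(1) lt(1,3)]
          avg[OF ends(2) lt(2,4)] ij distrib_left flip: node)
  qed
  then show thesis using that[OF mp f F] by blast
qed

lemma noninterior_face_term:
  assumes "F \<in> mesh_faces M" "F \<notin> interior_faces M"
  obtains m f where "m < n_el M" "f < 4" "F = cell_face M m f"
    "\<forall>i<n_el M. \<forall>j<4. \<forall>i'<n_el M. \<forall>j'<4. face_term \<sigma> F i j i' j' =
      boundary_node_term (\<sigma> / (2 * sqrt 2)) f m (face_end1 f) i j i' j' +
      boundary_node_term (\<sigma> / (2 * sqrt 2)) f m (face_end2 f) i j i' j'"
proof -
  obtain m f where m: "m < n_el M" and f: "f < 4" and F: "F = cell_face M m f"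
    and minus: "face_minus M F = m" and nrm: "face_normal M F = outer_normal f"
    using noninterior_face_cases[OF assms] by metis
  have "face_term \<sigma> F i j i' j' =
      boundary_node_term (\<sigma> / (2 * sqrt 2)) f m (face_end1 f) i j i' j' +
      boundary_node_term (\<sigma> / (2 * sqrt 2)) f m (face_end2 f) i j i' j'"
    if ij: "i < n_el M" "j < 4" "i' < n_el M" "j' < 4" for i j i' j'
  proof -
    have jmp: "jump M F (basis_fun M i j) (vertex M m e) = side_value m e i j"
      if "e < 4" "i < n_el M" "j < 4" for e i j
      using cell_trace_basis_fun_side_value[OF that(2) m that(3,1)] assms
      by (simp add: jump_def minus)
    have avg: "average M F (\<lambda>y. inner (grad (basis_fun M i j) y) (outer_normal f)) (vertex M m e)
        = side_flux f m e i j / side M" if "e < 4" for e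
      using cell_trace_grad_side_flux[OF ij(1) m ij(2) that, of f] assms
      by (simp add: average_def minus)
    have node: "- (side M / 2 * (side_flux f m e i j / side M * side_value m e i' j'))
        + \<sigma> / mesh_size M * (side M / 2 * (side_value m e i j * side_value m e i' j'))
        = boundary_node_term (\<sigma> / (2 * sqrt 2)) f m e i j i' j'" for e
      unfolding penalty_scaling boundary_node_term_def using side_pos by simp
    show ?thesis
      unfolding face_term_def nrm
      unfolding F quad_face_cell_face[OF side_pos f] unfolding F[symmetric]
      by (simp add: jmp avg face_ends_less_4 f ij distrib_left flip: node)
  qed
  then show thesis using that[OF m f F] by blast
qed

text \<open>The bound \<open>1/2\<close> is not sharp for interior faces, but it is sharp for Dirichlet faces and already
  balanced by the stiffness term.\<close>

lemma face_term_le: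
  assumes "F \<in> mesh_faces M" and \<sigma>: "sqrt 2 / 2 < \<sigma>"
    and ij: "i < n_el M" "j < 4" "i' < n_el M" "j' < 4" "(i, j) \<noteq> (i', j')"
  shows "face_term \<sigma> F i j i' j' \<le>
    (if i = i' \<and> adjacent j j' \<and> F = cell_face M i' (away_face j j') then 1/2 else 0)"
proof (cases "F \<in> interior_faces M")
  case True
  have c: "1/4 < \<sigma> / (2 * sqrt 2)"
  proof -
    have "sqrt 2 / 2 / (2 * sqrt 2) < \<sigma> / (2 * sqrt 2)"
      using \<sigma> by (intro divide_strict_right_mono) auto
    then show ?thesis by simp
  qed
  obtain m p f where mp: "m < n_el M" "p < n_el M" "m \<noteq> p" and f: "f < 4"
    and F: "F = cell_face M m f" "F = cell_face M p (opp_face f)"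
    and eq: "\<forall>i<n_el M. \<forall>j<4. \<forall>i'<n_el M. \<forall>j'<4. face_term \<sigma> F i j i' j' =
      interior_node_term (\<sigma> / (2 * sqrt 2)) f m (face_end1 f) p (face_end1 (opp_face f)) i j i' j' +
      interior_node_term (\<sigma> / (2 * sqrt 2)) f m (face_end2 f) p (face_end2 (opp_face f)) i j i' j'"
    using interior_face_term[OF True, of \<sigma>] by metis
  let ?crit = "i = i' \<and> adjacent j j' \<and>
      (i' = m \<and> f = away_face j j' \<or> i' = p \<and> opp_face f = away_face j j')"
  have node: "interior_node_term (\<sigma> / (2 * sqrt 2)) f m e p e' i j i' j' \<le> (if ?crit then 1/4 else 0)"
    if "face_end f e" "face_end (opp_face f) e'" for e e'
    by (rule interior_node_term_le[OF c f ij(2,4) mp(3) that ij(5)])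
  have "face_term \<sigma> F i j i' j' \<le> (if ?crit then 1/2 else 0)"
    using node[of "face_end1 f" "face_end1 (opp_face f)"] node[of "face_end2 f" "face_end2 (opp_face f)"]
      eq[rule_format, OF ij(1-4)] by (auto simp: face_end_def split: if_splits)
  also have "\<dots> \<le> (if i = i' \<and> adjacent j j' \<and> F = cell_face M i' (away_face j j') then 1/2 else 0)"
  proof -
    have "F = cell_face M i' (away_face j j')" if ?crit
      using that F by metis
    then show ?thesis by simp
  qed
  finally show ?thesis .
next
  case False
  obtain m f where m: "m < n_el M" and f: "f < 4" and F: "F = cell_face M m f"
    and eq: "\<forall>i<n_el M. \<forall>j<4. \<forall>i'<n_el M. \<forall>j'<4. face_term \<sigma> F i j i' j' =
      boundary_node_term (\<sigma> / (2 * sqrt 2)) f m (face_end1 f) i j i' j' +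
      boundary_node_term (\<sigma> / (2 * sqrt 2)) f m (face_end2 f) i j i' j'"
    using noninterior_face_term[OF assms(1) False, of \<sigma>] by metis
  let ?crit = "i = i' \<and> adjacent j j' \<and> i' = m \<and> f = away_face j j'"
  have node: "boundary_node_term (\<sigma> / (2 * sqrt 2)) f m e i j i' j' \<le> (if ?crit \<and> j' = e then 1/2 else 0)"
    if "face_end f e" for e
    using boundary_node_term_le[OF f ij(2,4) that ij(5)] by simp
  have "face_end1 f \<noteq> face_end2 f"
    using f by (elim less_4_cases) (simp_all add: face_table)
  \<comment> \<open>The two ends of the face are distinct, so at most one of them is the vertex of the test function.\<close>
  moreover have "(if P \<and> x = a then 1/2 else 0) + (if P \<and> x = b then 1/2 else 0) \<le> (if P then 1/2 else 0 :: real)"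
    if "a \<noteq> b" for P and x a b :: nat
    using that by simp
  ultimately have "(if ?crit \<and> j' = face_end1 f then 1/2 else 0 :: real) +
      (if ?crit \<and> j' = face_end2 f then 1/2 else 0) \<le> (if ?crit then 1/2 else 0)"
    by blast
  then have "face_term \<sigma> F i j i' j' \<le> (if ?crit then 1/2 else 0)"
    using node[of "face_end1 f"] node[of "face_end2 f"] eq[rule_format, OF ij(1-4)]
    unfolding face_end_def by linarith
  also have "\<dots> \<le> (if i = i' \<and> adjacent j j' \<and> F = cell_face M i' (away_face j j') then 1/2 else 0)"
  proof -
    have "F = cell_face M i' (away_face j j')" if ?crit
      using that F by metis
    then show ?thesis by simp
  qed
  finally show ?thesis .
qed

lemma sum_face_term_nonneg:
  assumes "F \<in> mesh_faces M" "0 \<le> \<sigma>" "i' < n_el M" "j' < 4"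
  shows "0 \<le> (\<Sum>i<n_el M. \<Sum>j<4. face_term \<sigma> F i j i' j')"
proof (cases "F \<in> interior_faces M")
  case True
  obtain m p f where mp: "m < n_el M" "p < n_el M" "m \<noteq> p" and f: "f < 4"
    and "F = cell_face M m f" "F = cell_face M p (opp_face f)"
    and eq: "\<forall>i<n_el M. \<forall>j<4. \<forall>i'<n_el M. \<forall>j'<4. face_term \<sigma> F i j i' j' =
      interior_node_term (\<sigma> / (2 * sqrt 2)) f m (face_end1 f) p (face_end1 (opp_face f)) i j i' j' +
      interior_node_term (\<sigma> / (2 * sqrt 2)) f m (face_end2 f) p (face_end2 (opp_face f)) i j i' j'"
    using interior_face_term[OF True, of \<sigma>] by metis
  have "(\<Sum>i<n_el M. \<Sum>j<4. face_term \<sigma> F i j i' j') = 0"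
    using mp f assms(3,4) by (simp add: eq sum.distrib sum_interior_node_term face_ends_less_4)
  then show ?thesis by simp
next
  case False
  obtain m f where m: "m < n_el M" and f: "f < 4" and "F = cell_face M m f"
    and eq: "\<forall>i<n_el M. \<forall>j<4. \<forall>i'<n_el M. \<forall>j'<4. face_term \<sigma> F i j i' j' =
      boundary_node_term (\<sigma> / (2 * sqrt 2)) f m (face_end1 f) i j i' j' +
      boundary_node_term (\<sigma> / (2 * sqrt 2)) f m (face_end2 f) i j i' j'"
    using noninterior_face_term[OF assms(1) False, of \<sigma>] by metis
  have "(\<Sum>i<n_el M. \<Sum>j<4. face_term \<sigma> F i j i' j') =
      \<sigma> / (2 * sqrt 2) * side_value m (face_end1 f) i' j' + \<sigma> / (2 * sqrt 2) * side_value m (face_end2 f) i' j'"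
    using m f assms(3,4) by (simp add: eq sum.distrib sum_boundary_node_term face_ends_less_4)
  then show ?thesis using assms(2) by (simp add: side_value_def)
qed

text \<open>The face sum exceeds \<open>0\<close> only for adjacent vertices of one cell and then by at most \<open>1/2\<close>, coming
  from a single face; the stiffness term is \<open>-1/2\<close> in exactly this case.\<close>

lemma iipg_form_offdiagonal_nonpos:
  assumes "FD \<subseteq> mesh_faces M" "sqrt 2 / 2 < \<sigma>"
    and ij: "i < n_el M" "j < 4" "i' < n_el M" "j' < 4" "(i, j) \<noteq> (i', j')"
  shows "iipg_form M FD \<sigma> (basis_fun M i j) (basis_fun M i' j') \<le> 0"
proof -
  let ?S = "interior_faces M \<union> FD"
  have S: "?S \<subseteq> mesh_faces M" "finite ?S"
    using assms(1) interior_faces_subset finite_mesh_faces by (auto dest: finite_subset)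
  have "(\<Sum>F\<in>?S. face_term \<sigma> F i j i' j') \<le>
      (\<Sum>F\<in>?S. if F = cell_face M i' (away_face j j') then if i = i' \<and> adjacent j j' then 1/2 else 0 else 0)"
  proof (rule sum_mono)
    fix F assume "F \<in> ?S"
    then have "F \<in> mesh_faces M" using S(1) by blast
    from face_term_le[OF this assms(2) ij]
    show "face_term \<sigma> F i j i' j' \<le>
        (if F = cell_face M i' (away_face j j') then if i = i' \<and> adjacent j j' then 1/2 else 0 else 0)"
      by (auto split: if_splits)
  qed
  also have "\<dots> \<le> (if i = i' \<and> adjacent j j' then 1/2 else 0)"
    using S(2) by (simp add: sum.delta)
  also have "\<dots> \<le> - stiffness_term i j i' j'"
    using ij ref_stiffness[of j j'] by (auto simp: stiffness_term_eq)
  finally show ?thesis by (simp add: iipg_form_basis_fun)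
qed

text \<open>The form applied to the constant \<open>1\<close>.\<close>

lemma iipg_form_row_sum_nonneg:
  assumes "FD \<subseteq> mesh_faces M" "0 \<le> \<sigma>" "i' < n_el M" "j' < 4"
  shows "0 \<le> (\<Sum>i<n_el M. \<Sum>j<4. iipg_form M FD \<sigma> (basis_fun M i j) (basis_fun M i' j'))"
proof -
  let ?S = "interior_faces M \<union> FD"
  have "(\<Sum>j<4. stiffness_term i j i' j') = 0" if "i < n_el M" for i
  proof -
    have "(\<Sum>j<4. stiffness_term i j i' j') =
        (if i = i' then (\<Sum>j<4. \<Sum>k<4. inner (ref_grad j k) (ref_grad j' k)) / 4 else 0)"
      using assms(3,4) that by (simp add: stiffness_term_eq sum_divide_distrib)
    also have "(\<Sum>j<4. \<Sum>k<4. inner (ref_grad j k) (ref_grad j' k)) =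
        (\<Sum>k<4. inner (\<Sum>j<4. ref_grad j k) (ref_grad j' k))"
      unfolding inner_sum_left by (rule sum.swap)
    finally show ?thesis by (simp add: sum_ref_grad)
  qed
  then have "(\<Sum>i<n_el M. \<Sum>j<4. iipg_form M FD \<sigma> (basis_fun M i j) (basis_fun M i' j')) =
      (\<Sum>i<n_el M. \<Sum>j<4. \<Sum>F\<in>?S. face_term \<sigma> F i j i' j')"
    by (simp add: iipg_form_basis_fun sum.distrib)
  also have "\<dots> = (\<Sum>F\<in>?S. \<Sum>i<n_el M. \<Sum>j<4. face_term \<sigma> F i j i' j')"
    unfolding sum.swap[of _ ?S "{..<4::nat}"] by (rule sum.swap)
  also have "\<dots> \<ge> 0"
    using assms interior_faces_subset by (intro sum_nonneg sum_face_term_nonneg) auto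
  finally show ?thesis .
qed

end

section \<open>The system matrix\<close>

lemma sum_pair_index:
  fixes g :: "nat \<Rightarrow> nat \<Rightarrow> 'a::comm_monoid_add"
  shows "(\<Sum>c<4 * n. g (c div 4) (c mod 4)) = (\<Sum>i<n. \<Sum>j<4. g i j)"
proof -
  have "(\<Sum>c\<in>{i * 4..<i * 4 + 4}. g (c div 4) (c mod 4)) = (\<Sum>j<4. g i j)" for i
    using sum.shift_bounds_nat_ivl[of "\<lambda>c. g (c div 4) (c mod 4)" 0 "i * 4" 4]
    by (simp add: atLeast0LessThan add.commute)
  then show ?thesis
    using sum.nat_group[of "\<lambda>c. g (c div 4) (c mod 4)" 4 n] by (simp add: mult.commute)
qed

theorem mainTheorem2:
  fixes M :: square_mesh
    and FD FN :: "(real \<times> real) set set"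
    and \<rho> :: "real \<times> real \<Rightarrow> real"
    and \<Delta>t lam Rey \<sigma> :: real
  assumes "conforming_mesh M"
    and "FD \<union> FN = boundary_faces M" and "FD \<inter> FN = {}"
    and "0 < \<Delta>t" and "0 < lam" and "0 < Rey"
    and "\<rho> \<in> dg_space M"
    and "\<And>i j. i < n_el M \<Longrightarrow> j < 4 \<Longrightarrow> 0 < cell_trace M i \<rho> (vertex M i j)"
    and "\<sigma> > sqrt 2 / 2"
  defines "A \<equiv> mass_matrix M \<rho> + (\<Delta>t * lam / Rey) \<cdot>\<^sub>m diffusion_matrix M FD \<sigma>"
  shows "M_matrix A \<and> invertible_mat A \<and> monotone_matrix A"
proof -
  interpret conforming_square_mesh M by standard (fact assms(1))
  define \<kappa> where "\<kappa> = \<Delta>t * lam / Rey"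
  define N where "N = 4 * n_el M"
  have \<kappa>: "0 < \<kappa>" using assms(4-6) by (simp add: \<kappa>_def)
  have \<sigma>: "0 \<le> \<sigma>" using assms(9) real_sqrt_ge_zero[of 2] by linarith
  have FD: "FD \<subseteq> mesh_faces M" using assms(2) by (auto simp: boundary_faces_def)
  have A: "A \<in> carrier_mat N N"
    by (simp add: A_def mass_matrix_def diffusion_matrix_def pair_matrix_def N_def)
  define a where "a i' j' i j = (if i = i' \<and> j = j' then (side M)\<^sup>2 / 4 * cell_trace M i \<rho> (vertex M i j) else 0)
      + \<kappa> * iipg_form M FD \<sigma> (basis_fun M i j) (basis_fun M i' j')" for i' j' i j
  have index: "r div 4 < n_el M" "r mod 4 < 4" if "r < N" for r
    using that by (auto simp: N_def)
  have entry: "A $$ (r, c) = a (r div 4) (r mod 4) (c div 4) (c mod 4)" if "r < N" "c < N" for r c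
    using that index[OF that(1)] index[OF that(2)] mass_entry[OF assms(7)]
    by (simp add: A_def mass_matrix_def diffusion_matrix_def pair_matrix_def N_def a_def \<kappa>_def)
  have offdiag: "A $$ (r, c) \<le> 0" if "r < N" "c < N" "r \<noteq> c" for r c
  proof -
    have ne: "(c div 4, c mod 4) \<noteq> (r div 4, r mod 4)"
      using that(3) by (metis div_mult_mod_eq prod.inject)
    then have "a (r div 4) (r mod 4) (c div 4) (c mod 4) =
        \<kappa> * iipg_form M FD \<sigma> (basis_fun M (c div 4) (c mod 4)) (basis_fun M (r div 4) (r mod 4))"
      by (auto simp: a_def)
    with iipg_form_offdiagonal_nonpos[OF FD assms(9) index[OF that(2)] index[OF that(1)] ne] \<kappa>
    show ?thesis by (simp add: entry that mult_le_0_iff)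
  qed
  have rows: "0 < (\<Sum>c<N. A $$ (r, c))" if r: "r < N" for r
  proof -
    define i' j' where "i' = r div 4" and "j' = r mod 4"
    have ij': "i' < n_el M" "j' < 4" using index[OF r] by (simp_all add: i'_def j'_def)
    have "(\<Sum>c<N. A $$ (r, c)) = (\<Sum>c<4 * n_el M. a i' j' (c div 4) (c mod 4))"
      using r by (simp add: entry N_def[symmetric] i'_def j'_def)
    also have "\<dots> = (\<Sum>i<n_el M. \<Sum>j<4. a i' j' i j)"
      by (rule sum_pair_index)
    also have "\<dots> = (\<Sum>i<n_el M. \<Sum>j<4. if i = i' then if j = j'
          then (side M)\<^sup>2 / 4 * cell_trace M i' \<rho> (vertex M i' j') else 0 else 0)
        + \<kappa> * (\<Sum>i<n_el M. \<Sum>j<4. iipg_form M FD \<sigma> (basis_fun M i j) (basis_fun M i' j'))"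
      unfolding a_def sum.distrib sum_distrib_left
      by (intro arg_cong2[where f = "(+)"] sum.cong refl) auto
    also have "(\<Sum>i<n_el M. \<Sum>j<4. if i = i' then if j = j'
          then (side M)\<^sup>2 / 4 * cell_trace M i' \<rho> (vertex M i' j') else 0 else 0) =
        (\<Sum>i<n_el M. if i = i' then \<Sum>j<4. if j = j'
          then (side M)\<^sup>2 / 4 * cell_trace M i' \<rho> (vertex M i' j') else 0 else 0)"
      by (intro sum.cong) auto
    also have "\<dots> = (side M)\<^sup>2 / 4 * cell_trace M i' \<rho> (vertex M i' j')"
      using ij' by simp
    finally show ?thesis
      using iipg_form_row_sum_nonneg[OF FD \<sigma> ij'] \<kappa> assms(8)[OF ij'] side_pos
      by (auto intro!: add_pos_nonneg mult_pos_pos)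
  qed
  have N: "0 < N" using n_el_pos by (simp add: N_def)
  show ?thesis
    using Z_matrix_positive_row_sums_M_matrix[OF A N offdiag rows]
      Z_matrix_positive_row_sums_invertible[OF A offdiag rows]
      Z_matrix_positive_row_sums_monotone[OF A offdiag rows] by blast
qed

end
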